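(* Let $\psi:\mathcal{H}\to\mathbb{R}$ be of class $C^2$ and bounded below, assume that $V(x)=\frac12\|\nabla\psi(x)\|^2$ is convex on $\mathcal{H}$, and let $T>0$. Then $u\in C^0([0,T];\mathcal{H})\cap C^1((0,T);\mathcal{H})$ is a solution of $u'(t)=-\nabla\psi(u(t))$ on $[0,T]$ if and only if $$J(T;u)\le J(T;w)$$ for all $w\in C^0([0,T];\mathcal{H})\cap C^1((0,T);\mathcal{H})$ satisfying $w(0)=u(0)$.
   Context: $\mathcal{H}$ is a real Hilbert space with norm $\|\cdot\|$. For $T>0$ the functional $J$ is defined by $$J(T;w)=\int_0^T\left(\tfrac12\|w'(t)\|^2+\tfrac12\|\nabla\psi(w(t))\|^2\right)dt+\psi(w(T)),$$ with value $+\infty$ when the integral diverges. *)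

theory Defs
  imports "HOL-Analysis.Analysis"
begin

text \<open>
  A real Hilbert space is a type of sort \<open>{real_inner, complete_space}\<close>. The library has the
  relation \<open>GDERIV f x :> D\<close>; on a Hilbert space the gradient of a differentiable function exists
  by the Riesz representation theorem and is unique.
\<close>

definition grad :: "('a::real_inner \<Rightarrow> real) \<Rightarrow> 'a \<Rightarrow> 'a" where
  "grad f x = (THE D. GDERIV f x :> D)"

text \<open>Class \<open>C\<^sup>2\<close> on the whole space: two Frechet derivatives, the second one continuous in
  operator norm.\<close>

definition C2_function :: "('a::real_normed_vector \<Rightarrow> 'b::real_normed_vector) \<Rightarrow> bool" where
  "C2_function f \<longleftrightarrow>
    (\<exists>(f' :: 'a \<Rightarrow> 'a \<Rightarrow>\<^sub>L 'b) (f'' :: 'a \<Rightarrow> 'a \<Rightarrow>\<^sub>L 'a \<Rightarrow>\<^sub>L 'b).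
      (\<forall>x. (f has_derivative blinfun_apply (f' x)) (at x)) \<and>
      (\<forall>x. (f' has_derivative blinfun_apply (f'' x)) (at x)) \<and>
      continuous_on UNIV f'')"

text \<open>Curves are total functions on the reals; only their values on \<open>[0,T]\<close> matter.\<close>

definition admissible_curve :: "real \<Rightarrow> (real \<Rightarrow> 'a::real_normed_vector) \<Rightarrow> bool" where
  "admissible_curve T w \<longleftrightarrow> continuous_on {0..T} w \<and> w C1_differentiable_on {0<..<T}"

text \<open>
  The integrand is nonnegative, so the integral is taken as a nonnegative Lebesgue integral, which
  is \<open>\<infinity>\<close> exactly when the integral diverges. It runs over the open interval, where an admissible
  curve is differentiable.
\<close>

definition J :: "('a::real_inner \<Rightarrow> real) \<Rightarrow> real \<Rightarrow> (real \<Rightarrow> 'a) \<Rightarrow> ereal" where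
  "J \<psi> T w =
    enn2ereal (\<integral>\<^sup>+t\<in>{0<..<T}. ennreal (1/2 * (norm (vector_derivative w (at t)))\<^sup>2
                                     + 1/2 * (norm (grad \<psi> (w t)))\<^sup>2) \<partial>lborel)
    + ereal (\<psi> (w T))"

text \<open>The equation is required at every point of \<open>[0,T]\<close>, with one-sided derivatives at the end
  points.\<close>

definition gradient_flow_on :: "('a::real_inner \<Rightarrow> real) \<Rightarrow> real \<Rightarrow> (real \<Rightarrow> 'a) \<Rightarrow> bool" where
  "gradient_flow_on \<psi> T u \<longleftrightarrow>
    (\<forall>t\<in>{0..T}. (u has_vector_derivative - grad \<psi> (u t)) (at t within {0..T}))"

end

theory Submission
  imports Defs
begin

text \<open>
  Completing the square, \<open>|w'|\<^sup>2 / 2 + |\<nabla>\<psi>(w)|\<^sup>2 / 2 = |w' + \<nabla>\<psi>(w)|\<^sup>2 / 2 - (\<psi> \<circ> w)'\<close>. Integrating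
  this identity over \<open>[0,T]\<close>, the boundary term at \<open>T\<close> cancels \<open>\<psi>(w(T))\<close> and
  \<open>J(T; w) = \<psi>(w(0)) + 1/2 \<integral> |w' + \<nabla>\<psi>(w)|\<^sup>2 dt\<close>.
  So \<open>J\<close> is bounded below by \<open>\<psi>(w(0))\<close>, a number that depends only on the initial value, and the
  bound is attained exactly by the gradient flows. Lemmas \<open>J_ge_initial_value_plus_defect\<close> and
  \<open>J_gradient_flow\<close> are the two halves of this argument. They show at once that a gradient flow
  minimises \<open>J\<close>.

  For the converse one has to know that the value \<open>\<psi>(u(0))\<close> is attained, that is, that some
  gradient flow starts at \<open>u(0)\<close> and lives on all of \<open>[0,T]\<close> (\<open>gradient_flow_exists\<close>). The gradient
  of a \<open>C\<^sup>2\<close> function is locally Lipschitz, so flows exist for short times by Picard iteration and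
  are unique. They do not stop before \<open>T\<close>: \<open>|u'| = |\<nabla>\<psi>(u)|\<close> and \<open>(\<psi> \<circ> u)' = - |\<nabla>\<psi>(u)|\<^sup>2\<close>, and since
  \<open>\<psi>\<close> is bounded below, the flow has finite action and is therefore uniformly continuous. Hence it
  has a limit at the end of its interval of existence, by completeness, and can be continued from
  there. A minimiser \<open>u\<close> then satisfies \<open>J(T; u) \<le> \<psi>(u(0))\<close>, so its defect \<open>u' + \<nabla>\<psi>(u)\<close> vanishes on
  \<open>(0,T)\<close>, and the equation extends to the end points because \<open>u\<close> is continuous on \<open>[0,T]\<close>.
\<close>

section \<open>Riesz representation and gradients\<close>

text \<open>
  The representing vector is the minimiser of \<open>Q(x) = |x|\<^sup>2 / 2 - f(x)\<close>. By the parallelogram law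
  every minimising sequence of \<open>Q\<close> is Cauchy, and at the minimum the first variation
  \<open>\<langle>h, D\<rangle> - f(h)\<close> vanishes in every direction \<open>h\<close>.
\<close>
lemma bounded_linear_eq_inner:
  fixes f :: "'a::{real_inner, complete_space} \<Rightarrow> real"
  assumes f: "bounded_linear f"
  obtains D where "\<And>x. f x = inner x D"
proof -
  interpret f: bounded_linear f by fact
  define Q where "Q x = (norm x)\<^sup>2 / 2 - f x" for x
  obtain K where K: "\<And>x. norm (f x) \<le> norm x * K"
    using f.bounded by blast
  have lower: "- K\<^sup>2 / 2 \<le> Q x" for x
  proof -
    have "0 \<le> (norm x - K)\<^sup>2" by simp
    moreover have "f x \<le> norm x * K" using K[of x] by simp
    ultimately show ?thesis
      unfolding Q_def by (simp add: power2_diff algebra_simps)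
  qed
  define m where "m = Inf (range Q)"
  have bdd: "bdd_below (range Q)"
    using lower by (auto intro!: bdd_belowI)
  have m: "m \<le> Q x" for x
    unfolding m_def by (rule cInf_lower) (use bdd in auto)
  have "\<exists>x. Q x < m + 1 / real (Suc n)" for n
    using cInf_lessD[of "range Q" "m + 1 / real (Suc n)"] unfolding m_def by auto
  then obtain X where X: "\<And>n. Q (X n) < m + 1 / real (Suc n)" by metis
  have par: "(norm (x - y))\<^sup>2 = 4 * (Q x + Q y - 2 * Q ((1/2) *\<^sub>R (x + y)))" for x y
    unfolding Q_def
    by (simp add: power2_norm_eq_inner f.scaleR f.add inner_simps inner_commute field_simps)
  have close: "(norm (X i - X j))\<^sup>2 \<le> 8 / real (Suc N)" if "N \<le> i" "N \<le> j" for i j N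
  proof -
    define e where "e = 1 / real (Suc N)"
    have le: "1 / real (Suc k) \<le> e" if "N \<le> k" for k
      unfolding e_def using that by (intro divide_left_mono) auto
    have "Q (X i) \<le> m + e" "Q (X j) \<le> m + e"
      using X[of i] X[of j] le[OF that(1)] le[OF that(2)] by linarith+
    moreover have "m \<le> Q ((1/2) *\<^sub>R (X i + X j))"
      by (rule m)
    ultimately have "4 * (Q (X i) + Q (X j) - 2 * Q ((1/2) *\<^sub>R (X i + X j))) \<le> 8 * e"
      by (simp add: field_simps)
    then show ?thesis by (simp add: par e_def)
  qed
  have "Cauchy X"
  proof (rule metric_CauchyI)
    fix e :: real assume "0 < e"
    obtain N where "8 / e\<^sup>2 < real N"
      using reals_Archimedean2 by blast
    then have N: "8 / e\<^sup>2 < real (Suc N)" by simp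
    have "dist (X i) (X j) < e" if "N \<le> i" "N \<le> j" for i j
    proof (rule power2_less_imp_less)
      have "8 / real (Suc N) < e\<^sup>2"
        using N \<open>0 < e\<close> by (simp add: field_simps)
      then show "(dist (X i) (X j))\<^sup>2 < e\<^sup>2"
        using close[OF that] by (simp add: dist_norm)
    qed (use \<open>0 < e\<close> in simp)
    then show "\<exists>M. \<forall>m\<ge>M. \<forall>n\<ge>M. dist (X m) (X n) < e" by blast
  qed
  then obtain D where D: "X \<longlonglongrightarrow> D"
    using Cauchy_convergent convergentD by blast
  have "(\<lambda>n. Q (X n)) \<longlonglongrightarrow> Q D"
    unfolding Q_def by (intro tendsto_intros D f.tendsto) simp_all
  moreover have "(\<lambda>n. m + 1 / real (Suc n)) \<longlonglongrightarrow> m + 0"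
    by (intro tendsto_add tendsto_const LIMSEQ_Suc[OF lim_1_over_n])
  ultimately have "Q D \<le> m + 0"
    using X by (intro LIMSEQ_le) (auto intro: less_imp_le)
  then have min: "Q D \<le> Q y" for y
    using m[of y] by simp
  have "f h = inner h D" for h
  proof -
    define c where "c = inner h D - f h"
    define n where "n = (norm h)\<^sup>2"
    have n: "n \<ge> 0" by (simp add: n_def)
    have "0 \<le> t * c + t\<^sup>2 * n / 2" for t
      using min[of "D + t *\<^sub>R h"]
      unfolding Q_def c_def n_def
      by (simp add: power2_norm_eq_inner f.scaleR f.add inner_simps inner_commute
          power2_eq_square[of t] field_simps)
    \<comment> \<open>at \<open>t = - c / (n + 1)\<close> the quadratic term is too small to compensate the linear one\<close>
    from this[of "- c / (n + 1)"]
    have "0 \<le> - c\<^sup>2 / (n + 1) + c\<^sup>2 * n / (2 * (n + 1)\<^sup>2)"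
      by (simp add: power_divide power2_eq_square[of c])
    also have "\<dots> = - (c\<^sup>2 * (n + 2) / (2 * (n + 1)\<^sup>2))"
      using n by (simp add: divide_simps) (simp add: algebra_simps power2_eq_square)
    finally have "c\<^sup>2 * (n + 2) \<le> 0"
      using n by (simp add: divide_le_0_iff)
    then have "c = 0"
      using n by (simp add: mult_le_0_iff)
    then show ?thesis by (simp add: c_def)
  qed
  then show ?thesis by (rule that)
qed

text \<open>
  The Riesz vector of the derivative is a gradient, and it is the only one, so the definite
  description that defines \<open>grad\<close> picks it.
\<close>
lemma GDERIV_grad:
  fixes f :: "'a::{real_inner, complete_space} \<Rightarrow> real"
  assumes "f differentiable (at x)"
  shows "GDERIV f x :> grad f x"
proof -
  obtain f' where f': "(f has_derivative f') (at x)"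
    using assms unfolding differentiable_def by blast
  then obtain D where "\<And>h. f' h = inner h D"
    using bounded_linear_eq_inner has_derivative_bounded_linear by blast
  then have D: "GDERIV f x :> D"
    using f' unfolding gderiv_def by (metis has_derivative_eq_rhs ext)
  show ?thesis
    unfolding grad_def
  proof (rule theI[where P = "\<lambda>D. GDERIV f x :> D", OF D])
    fix D' assume "GDERIV f x :> D'"
    then have "(\<lambda>h. inner h D') = (\<lambda>h. inner h D)"
      using D has_derivative_unique unfolding gderiv_def by blast
    then show "D' = D"
      by (metis inner_commute vector_eq_ldot)
  qed
qed

text \<open>
  Near any point the second derivative is bounded, by continuity, so the first derivative is
  Lipschitz on a small ball. The Riesz map is an isometry and carries this over to the gradient.

  The notion \<open>local_lipschitz\<close> is meant for time-dependent families; an autonomous field is a family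
  over the one-point time set \<open>{0}\<close>.
\<close>
lemma local_lipschitz_grad:
  fixes f :: "'a::{real_inner, complete_space} \<Rightarrow> real"
  assumes "C2_function f"
  shows "local_lipschitz {0::real} UNIV (\<lambda>_. grad f)"
proof (rule local_lipschitzI)
  fix p :: 'a and s :: real
  obtain f' :: "'a \<Rightarrow> 'a \<Rightarrow>\<^sub>L real" and f'' :: "'a \<Rightarrow> 'a \<Rightarrow>\<^sub>L 'a \<Rightarrow>\<^sub>L real" where
    f': "\<And>x. (f has_derivative blinfun_apply (f' x)) (at x)" and
    f'': "\<And>x. (f' has_derivative blinfun_apply (f'' x)) (at x)" and
    cont: "continuous_on UNIV f''"
    using assms unfolding C2_function_def by blast
  have isCont: "isCont f'' p"
    using cont by (simp add: continuous_on_eq_continuous_at)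
  then obtain d where d: "d > 0" "\<And>x. dist x p < d \<Longrightarrow> dist (f'' x) (f'' p) < 1"
    unfolding continuous_at_eps_delta by (metis zero_less_one)
  define K where "K = norm (f'' p) + 1"
  have K: "norm (f'' x) \<le> K" if "x \<in> cball p (d/2)" for x
  proof -
    have "dist (f'' x) (f'' p) < 1"
      using that d by (intro d(2)) (auto simp: dist_commute)
    then show ?thesis
      using norm_triangle_sub[of "f'' x" "f'' p"] unfolding K_def dist_norm by linarith
  qed
  have lip': "norm (f' x - f' y) \<le> K * norm (x - y)" if "x \<in> cball p (d/2)" "y \<in> cball p (d/2)" for x y
    using K that
    by (intro differentiable_bound[where S = "cball p (d/2)" and f' = "\<lambda>x. blinfun_apply (f'' x)"])
       (auto simp: norm_blinfun.rep_eq[symmetric] intro: has_derivative_at_withinI f'')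
  have f'_eq: "blinfun_apply (f' x) h = inner h (grad f x)" for x h
    using GDERIV_grad[of f x] f'[of x] has_derivative_unique unfolding gderiv_def differentiable_def
    by metis
  have "norm (grad f x - grad f y) \<le> norm (f' x - f' y)" for x y
  proof -
    define e where "e = grad f x - grad f y"
    have "norm e * norm e = blinfun_apply (f' x - f' y) e"
      by (simp add: blinfun.diff_left f'_eq inner_diff_right[symmetric] e_def
          power2_norm_eq_inner[symmetric] power2_eq_square)
    also have "\<dots> \<le> norm (f' x - f' y) * norm e"
      using norm_blinfun[of "f' x - f' y" e] by simp
    finally show ?thesis
      unfolding e_def[symmetric] by (cases "e = 0") auto
  qed
  then have "K-lipschitz_on (cball p (d/2) \<inter> UNIV) (grad f)"
    using order_trans[OF _ lip'] by (intro lipschitz_onI) (auto simp: dist_norm K_def)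
  then show "\<exists>u>0. \<exists>L. \<forall>t\<in>cball s u \<inter> {0}. L-lipschitz_on (cball p u \<inter> UNIV) (grad f)"
    using d(1) by (intro exI[of _ "d/2"]) auto
qed

section \<open>Local existence of solutions of an autonomous equation\<close>

text \<open>
  The Henstock-Kurzweil integral is defined for types of class \<open>banach\<close>. A type variable of the
  sort \<open>{real_normed_vector, complete_space}\<close> carries the same data but is not an instance of that
  class, so integrals with values in it cannot be written down directly. The function space
  \<open>real \<Rightarrow>\<^sub>C 'a\<close> can be declared an instance, and it contains \<open>'a\<close> isometrically as the
  constant functions; integrals are formed there.
\<close>
instance bcontfun :: (metric_space, "{real_normed_vector, complete_space}") banach ..

text \<open>
  The integral of \<open>f\<close> is computed among the constant functions and brought back by evaluation at
  a point, which is bounded and linear.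
\<close>
lemma continuous_has_antiderivative:
  fixes f :: "real \<Rightarrow> 'a::{real_normed_vector, complete_space}"
  assumes "continuous_on {a..b} f"
  obtains G where "\<And>t. t \<in> {a..b} \<Longrightarrow> (G has_vector_derivative f t) (at t within {a..b})"
proof -
  define C :: "'a \<Rightarrow> real \<Rightarrow>\<^sub>C 'a" where "C = const_bcontfun"
  have C: "apply_bcontfun (C x) 0 = x" for x
    by (simp add: C_def const_bcontfun.rep_eq)
  have "dist (C x) (C y) \<le> dist x y" for x y
    by (rule dist_bound) (simp add: C_def const_bcontfun.rep_eq)
  then have contC: "continuous_on UNIV C"
    by (intro continuous_onI) (metis order_le_less_trans less_imp_le)
  have eval: "bounded_linear (\<lambda>g :: real \<Rightarrow>\<^sub>C 'a. apply_bcontfun g 0)"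
    by (rule bounded_linear_intro[where K = 1])
       (simp_all add: plus_bcontfun.rep_eq scaleR_bcontfun.rep_eq norm_bounded)
  have "continuous_on {a..b} (\<lambda>t. C (f t))"
    by (rule continuous_on_compose2[OF contC assms]) auto
  note integral_has_vector_derivative[OF this]
  from bounded_linear.has_vector_derivative[OF eval this]
  show ?thesis
    by (intro that[of "\<lambda>t. apply_bcontfun (integral {a..t} (\<lambda>t. C (f t))) 0"]) (simp add: C)
qed

definition flow_on :: "('a::real_normed_vector \<Rightarrow> 'a) \<Rightarrow> real \<Rightarrow> (real \<Rightarrow> 'a) \<Rightarrow> bool" where
  "flow_on F T u \<longleftrightarrow>
    (\<forall>t\<in>{0..T}. (u has_vector_derivative F (u t)) (at t within {0..T}))"

lemma flow_on_subset:
  assumes "flow_on F T u" "S \<le> T"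
  shows "flow_on F S u"
  using assms unfolding flow_on_def
  by (meson atLeastAtMost_iff atLeastatMost_subset_iff has_vector_derivative_within_subset order_refl order_trans)

lemma flow_on_continuous:
  assumes "flow_on F T u"
  shows "continuous_on {0..T} u"
  using assms unfolding flow_on_def
  by (intro continuous_on_vector_derivative) blast

lemma flow_on_at:
  assumes "flow_on F T u" "0 < t" "t < T"
  shows "(u has_vector_derivative F (u t)) (at t)"
proof -
  have "t \<in> {0..T}" using assms by simp
  with assms(1) have "(u has_vector_derivative F (u t)) (at t within {0..T})"
    unfolding flow_on_def by blast
  then show ?thesis
    using assms by (simp add: at_within_Icc_at)
qed

lemma vector_derivative_increment_bound:
  fixes f :: "real \<Rightarrow> 'a::real_normed_vector"
  assumes "\<And>t. t \<in> {a..b} \<Longrightarrow> (f has_vector_derivative f' t) (at t within {a..b})"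
    and "\<And>t. t \<in> {a..b} \<Longrightarrow> norm (f' t) \<le> B"
    and "x \<in> {a..b}" "y \<in> {a..b}"
  shows "norm (f x - f y) \<le> B * \<bar>x - y\<bar>"
proof -
  have "onorm (\<lambda>h. h *\<^sub>R f' t) \<le> B" if "t \<in> {a..b}" for t
    using assms(2)[OF that] by (simp add: onorm_scaleR_left[OF bounded_linear_ident] onorm_id)
  then show ?thesis
    using differentiable_bound[of "{a..b}" f "\<lambda>t h. h *\<^sub>R f' t" B x y] assms
    by (simp add: has_vector_derivative_def)
qed

text \<open>
  Picard iteration. The constant \<open>M\<close> bounds \<open>|F|\<close> on the ball, and the time \<open>h\<close> is so short that a
  curve of speed at most \<open>M\<close> stays in the ball (\<open>M h \<le> r\<close>) and that the Picard operator contracts by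
  the factor \<open>1/2\<close> (\<open>L h \<le> 1/2\<close>). Curves are bounded continuous functions on the whole real line; the
  Picard operator freezes its values outside \<open>[0,h]\<close> by \<open>clamp\<close>, so that their supremum distance is
  already reached on \<open>[0,h]\<close>. No explicit integral is needed: the value of the operator at \<open>x\<close> is an
  antiderivative of \<open>F \<circ> x\<close> starting at \<open>p\<close>, and its estimates follow from the mean value inequality.
\<close>
lemma flow_on_exists_locally:
  fixes F :: "'a::{real_normed_vector, complete_space} \<Rightarrow> 'a"
  assumes "r > 0" and lip: "L-lipschitz_on (cball p r) F"
  obtains h u where "h > 0" "flow_on F h u" "u 0 = p"
proof -
  have "L \<ge> 0" using lip lipschitz_on_nonneg by blast
  define M where "M = norm (F p) + L * r"
  have "M \<ge> 0" using \<open>L \<ge> 0\<close> \<open>r > 0\<close> by (simp add: M_def)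
  have M: "norm (F x) \<le> M" if "x \<in> cball p r" for x
  proof -
    have "norm (F x - F p) \<le> L * norm (x - p)"
      using lipschitz_onD[OF lip that, of p] \<open>r > 0\<close> by (simp add: dist_norm)
    also have "\<dots> \<le> L * r"
      using that \<open>L \<ge> 0\<close> by (intro mult_left_mono) (auto simp: dist_norm norm_minus_commute)
    finally show ?thesis
      using norm_triangle_sub[of "F x" "F p"] unfolding M_def by linarith
  qed
  define h where "h = min (1 / (2 * (L + 1))) (r / (M + 1))"
  have h: "h > 0" using \<open>L \<ge> 0\<close> \<open>M \<ge> 0\<close> \<open>r > 0\<close> by (simp add: h_def)
  have "h \<le> 1 / (2 * (L + 1))" "h \<le> r / (M + 1)"
    unfolding h_def by simp_all
  then have "h * (2 * (L + 1)) \<le> 1" "h * (M + 1) \<le> r"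
    using \<open>L \<ge> 0\<close> \<open>M \<ge> 0\<close> by (simp_all add: pos_le_divide_eq)
  then have hL: "L * h \<le> 1/2" and hM: "M * h \<le> r"
    using h by (simp_all add: algebra_simps)
  define clamp where "clamp t = max 0 (min h t)" for t
  have clamp: "clamp t \<in> {0..h}" "t \<in> {0..h} \<Longrightarrow> clamp t = t" for t
    using h by (auto simp: clamp_def)
  define S :: "(real \<Rightarrow>\<^sub>C 'a) set" where "S = PiC UNIV (\<lambda>_. cball p r)"
  have S: "x \<in> S \<longleftrightarrow> (\<forall>t. apply_bcontfun x t \<in> cball p r)" for x
    by (auto simp: S_def mem_PiC_iff)
  have "\<exists>y :: real \<Rightarrow>\<^sub>C 'a. y 0 = p \<and> (\<forall>t. y t = y (clamp t)) \<and>
      (\<forall>t\<in>{0..h}. (y has_vector_derivative F (x t)) (at t within {0..h}))" if "x \<in> S" for x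
  proof -
    have "continuous_on {0..h} (\<lambda>t. F (x t))"
      using that by (intro continuous_on_compose2[OF lipschitz_on_continuous_on[OF lip]])
        (auto simp: S)
    then obtain G where
      G: "\<And>t. t \<in> {0..h} \<Longrightarrow> (G has_vector_derivative F (x t)) (at t within {0..h})"
      by (rule continuous_has_antiderivative) blast
    define y where "y t = p + (G (clamp t) - G 0)" for t
    have contG: "continuous_on {0..h} G"
      using G by (rule continuous_on_vector_derivative)
    have "continuous_on UNIV clamp"
      unfolding clamp_def by (intro continuous_intros)
    then have "continuous_on UNIV y"
      unfolding y_def
      by (intro continuous_intros continuous_on_compose2[OF contG]) (use clamp in auto)
    moreover have "bounded (range y)"
    proof (rule bounded_subset)
      show "bounded ((\<lambda>t. p + (G t - G 0)) ` {0..h})"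
        by (intro compact_imp_bounded compact_continuous_image continuous_intros contG) simp
      show "range y \<subseteq> (\<lambda>t. p + (G t - G 0)) ` {0..h}"
        unfolding y_def using clamp by auto
    qed
    ultimately obtain z :: "real \<Rightarrow>\<^sub>C 'a" where z: "y = apply_bcontfun z"
      by (auto simp: bcontfun_def intro: bcontfunE)
    have "(y has_vector_derivative F (x t)) (at t within {0..h})" if "t \<in> {0..h}" for t
    proof (rule has_vector_derivative_transform[OF that])
      show "((\<lambda>t. p + (G t - G 0)) has_vector_derivative F (x t)) (at t within {0..h})"
        using G[OF that] by (auto intro!: derivative_eq_intros)
    qed (simp add: y_def clamp)
    moreover have "y 0 = p" "\<And>t. y t = y (clamp t)"
      using clamp h by (auto simp: y_def)
    ultimately show ?thesis unfolding z by blast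
  qed
  then obtain P :: "(real \<Rightarrow>\<^sub>C 'a) \<Rightarrow> real \<Rightarrow>\<^sub>C 'a" where
    P0: "\<And>x. x \<in> S \<Longrightarrow> P x 0 = p" and
    Pclamp: "\<And>x t. x \<in> S \<Longrightarrow> P x t = P x (clamp t)" and
    P': "\<And>x t. x \<in> S \<Longrightarrow> t \<in> {0..h} \<Longrightarrow>
      (P x has_vector_derivative F (x t)) (at t within {0..h})"
    by metis
  have "\<exists>!x\<in>S. P x = x"
  proof (rule Banach_fix[where c = "1/2"])
    show "complete S"
      unfolding S_def complete_eq_closed by (rule closed_PiC) simp
    have "const_bcontfun p \<in> S"
      using \<open>r > 0\<close> by (simp add: S const_bcontfun.rep_eq)
    then show "S \<noteq> {}" by blast
    have "P x t \<in> cball p r" if "x \<in> S" for x t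
    proof -
      have "norm (P x (clamp t) - P x 0) \<le> M * \<bar>clamp t - 0\<bar>"
        by (rule vector_derivative_increment_bound[OF P'[OF that]])
          (use that h clamp M in \<open>auto simp: S\<close>)
      also have "\<dots> \<le> M * h"
        using clamp[of t] \<open>M \<ge> 0\<close> by (intro mult_left_mono) auto
      finally show ?thesis
        using hM Pclamp[OF that, of t] P0[OF that]
        by (simp add: dist_norm norm_minus_commute)
    qed
    then show "P ` S \<subseteq> S" by (auto simp: S)
    fix x y assume xy: "x \<in> S" "y \<in> S"
    have "dist (P x t) (P y t) \<le> 1/2 * dist x y" for t
    proof -
      have "norm ((P x (clamp t) - P y (clamp t)) - (P x 0 - P y 0)) \<le> (L * dist x y) * \<bar>clamp t - 0\<bar>"
      proof (rule vector_derivative_increment_bound)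
        show "((\<lambda>t. P x t - P y t) has_vector_derivative F (x s) - F (y s)) (at s within {0..h})"
          if "s \<in> {0..h}" for s
          by (intro has_vector_derivative_diff P' xy that)
        have "norm (F (x s) - F (y s)) \<le> L * dist (x s) (y s)" for s
          using lipschitz_onD[OF lip] xy by (simp add: S dist_norm)
        then show "norm (F (x s) - F (y s)) \<le> L * dist x y" for s
          using mult_left_mono[OF dist_bounded \<open>L \<ge> 0\<close>] order_trans by blast
      qed (use clamp h in auto)
      also have "\<dots> \<le> (L * dist x y) * h"
        using clamp[of t] \<open>L \<ge> 0\<close> by (intro mult_left_mono) auto
      also have "\<dots> = (L * h) * dist x y" by simp
      also have "\<dots> \<le> 1/2 * dist x y"
        by (intro mult_right_mono hL) simp
      finally show ?thesis
        using Pclamp[OF xy(1), of t] Pclamp[OF xy(2), of t] by (simp add: dist_norm P0 xy)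
    qed
    then show "dist (P x) (P y) \<le> 1/2 * dist x y" by (rule dist_bound)
  qed simp_all
  then obtain x where x: "x \<in> S" "P x = x" by blast
  show ?thesis
    using P0[OF x(1)] P'[OF x(1)] h by (intro that[of h x]) (auto simp: flow_on_def x(2))
qed

section \<open>Uniqueness and global existence\<close>

text \<open>
  At an end point the derivative is the limit of the derivatives nearby: the curve
  \<open>s \<mapsto> u(s) - s F(u(t))\<close> has derivative \<open>F(u(s)) - F(u(t))\<close>, which is small near \<open>t\<close>, and the mean
  value inequality turns this into the difference quotient at \<open>t\<close>. The estimate is the same for
  interior points, so no case distinction is made.
\<close>
lemma flow_onI_interior:
  fixes F :: "'a::real_normed_vector \<Rightarrow> 'a"
  assumes contF: "continuous_on UNIV F" and contu: "continuous_on {0..T} u"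
    and deriv: "\<And>t. 0 < t \<Longrightarrow> t < T \<Longrightarrow> (u has_vector_derivative F (u t)) (at t)"
  shows "flow_on F T u"
  unfolding flow_on_def has_vector_derivative_def has_derivative_within_alt
proof (intro ballI conjI allI impI)
  fix t :: real assume t: "t \<in> {0..T}"
  show "bounded_linear (\<lambda>x. x *\<^sub>R F (u t))" by (rule bounded_linear_scaleR_left)
  fix e :: real assume "0 < e"
  have "continuous_on {0..T} (\<lambda>s. F (u s))"
    by (rule continuous_on_compose2[OF contF contu]) auto
  then obtain d where "d > 0" and
    d: "\<And>s. s \<in> {0..T} \<Longrightarrow> dist s t < d \<Longrightarrow> dist (F (u s)) (F (u t)) < e"
    using t \<open>0 < e\<close> unfolding continuous_on_iff by metis
  define \<phi> where "\<phi> s = u s - s *\<^sub>R F (u t)" for s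
  have incr: "norm (\<phi> b - \<phi> a) \<le> e * b - e * a"
    if "a < b" "a \<in> {0..T}" "b \<in> {0..T}" "dist a t < d" "dist b t < d" for a b
  proof (rule differentiable_bound_general[OF \<open>a < b\<close>, where f' = "\<lambda>s. F (u s) - F (u t)" and \<phi>' = "\<lambda>_. e"])
    show "continuous_on {a..b} \<phi>"
      unfolding \<phi>_def using that
      by (intro continuous_intros continuous_on_subset[OF contu]) auto
    fix s assume s: "a < s" "s < b"
    then have "(u has_vector_derivative F (u s)) (at s)"
      using that by (intro deriv) auto
    then show "(\<phi> has_vector_derivative F (u s) - F (u t)) (at s)"
      unfolding \<phi>_def by (auto intro!: derivative_eq_intros)
    have "dist s t < d"
      using s that by (auto simp: dist_real_def)
    then show "norm (F (u s) - F (u t)) \<le> e"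
      using d[of s] s that by (auto simp: dist_norm)
  qed (auto intro!: continuous_intros derivative_eq_intros)
  have "norm (u y - u t - (y - t) *\<^sub>R F (u t)) \<le> e * norm (y - t)"
    if "y \<in> {0..T}" "norm (y - t) < d" for y
  proof -
    have eq: "u y - u t - (y - t) *\<^sub>R F (u t) = \<phi> y - \<phi> t"
      by (simp add: \<phi>_def algebra_simps)
    consider "y = t" | "t < y" | "y < t" by linarith
    then show ?thesis
    proof cases
      case 2
      then show ?thesis
        unfolding eq using incr[of t y] that t \<open>d > 0\<close> by (simp add: dist_norm algebra_simps)
    next
      case 3
      then show ?thesis
        unfolding eq using incr[of y t] that t \<open>d > 0\<close>
        by (simp add: dist_norm norm_minus_commute algebra_simps)
    qed simp
  qed
  then show "\<exists>d>0. \<forall>y\<in>{0..T}. norm (y - t) < d \<longrightarrow>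
      norm (u y - u t - (y - t) *\<^sub>R F (u t)) \<le> e * norm (y - t)"
    using \<open>d > 0\<close> by blast
qed

text \<open>
  Gronwall's argument: if \<open>K\<close> is a Lipschitz constant of \<open>F\<close> on the compact set formed by the two
  curves, then \<open>exp(-2Kt) |u(t) - v(t)|\<^sup>2\<close> does not increase, and it starts at \<open>0\<close>.
\<close>
lemma flow_on_unique:
  fixes F :: "'a::real_inner \<Rightarrow> 'a"
  assumes lip: "local_lipschitz {0::real} UNIV (\<lambda>_. F)"
    and u: "flow_on F T u" and v: "flow_on F T v" and "u 0 = v 0" and t: "t \<in> {0..T}"
  shows "u t = v t"
proof -
  note contu = flow_on_continuous[OF u] and contv = flow_on_continuous[OF v]
  define X where "X = u ` {0..T} \<union> v ` {0..T}"
  have "local_lipschitz {0::real} X (\<lambda>_. F)"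
    using lip by (rule local_lipschitz_subset) auto
  moreover have "compact X"
    unfolding X_def by (intro compact_Un compact_continuous_image contu contv) auto
  ultimately obtain K where K: "K-lipschitz_on X F"
    using local_lipschitz_compact_implies_lipschitz[of "{0::real}" X "\<lambda>_. F"] by auto
  define g where "g s = exp (- 2 * K * s) * (inner (u s - v s) (u s - v s))" for s
  have "g t \<le> g 0"
  proof (cases "t = 0")
    case False
    show ?thesis
    proof (rule DERIV_nonpos_imp_decreasing_open[where f = g])
      show "continuous_on {0..t} g"
        unfolding g_def using t
        by (intro continuous_intros continuous_on_subset[OF contu] continuous_on_subset[OF contv]) auto
      fix s assume s: "0 < s" "s < t"
      define d where "d = u s - v s"
      define D where "D = F (u s) - F (v s)"
      have "((\<lambda>s. u s - v s) has_vector_derivative D) (at s)"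
        using flow_on_at[OF u, of s] flow_on_at[OF v, of s] s t unfolding D_def
        by (auto intro: has_vector_derivative_diff)
      then have "((\<lambda>s. inner (u s - v s) (u s - v s)) has_derivative
          (\<lambda>h. inner d (h *\<^sub>R D) + inner (h *\<^sub>R D) d)) (at s)"
        unfolding has_vector_derivative_def d_def by (intro has_derivative_inner)
      then have "((\<lambda>s. inner (u s - v s) (u s - v s)) has_real_derivative 2 * inner d D) (at s)"
        by (rule has_derivative_imp_has_field_derivative) (simp add: inner_commute)
      then have "(g has_real_derivative
          exp (- 2 * K * s) * (2 * inner d D) + exp (- 2 * K * s) * (- 2 * K) * inner d d) (at s)"
        unfolding g_def d_def by (auto intro!: derivative_eq_intros)
      moreover have "inner d D \<le> K * inner d d"
      proof -
        have "norm D \<le> K * norm d"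
          using lipschitz_onD[OF K, of "u s" "v s"] s t by (auto simp: X_def D_def d_def dist_norm)
        then have "norm d * norm D \<le> norm d * (K * norm d)"
          by (rule mult_left_mono) simp
        then show ?thesis
          using norm_cauchy_schwarz[of d D]
          by (simp add: power2_norm_eq_inner[symmetric] power2_eq_square mult.left_commute)
      qed
      then have "exp (- 2 * K * s) * (2 * inner d D) + exp (- 2 * K * s) * (- 2 * K) * inner d d \<le> 0"
        by (simp add: algebra_simps)
      ultimately show "\<exists>y. (g has_real_derivative y) (at s) \<and> y \<le> 0" by blast
    qed (use t False in auto)
  qed simp
  then have "exp (- 2 * K * t) * inner (u t - v t) (u t - v t) \<le> 0"
    by (simp add: g_def \<open>u 0 = v 0\<close>)
  then have "inner (u t - v t) (u t - v t) \<le> 0"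
    by (simp add: mult_le_0_iff)
  then show ?thesis
    using inner_ge_zero[of "u t - v t"] by (simp add: inner_eq_zero_iff order_antisym)
qed

lemma flow_on_append:
  assumes u: "flow_on F \<sigma> u" and v: "flow_on F h v" and "v 0 = u \<sigma>" "0 \<le> \<sigma>" "0 \<le> h"
  shows "flow_on F (\<sigma> + h) (\<lambda>t. if t \<in> {0..\<sigma>} then u t else v (t - \<sigma>))"
  unfolding flow_on_def
proof
  fix t assume t: "t \<in> {0..\<sigma> + h}"
  have cl: "closure {0..\<sigma>} \<inter> closure {\<sigma>..\<sigma> + h} = {\<sigma>}" "{0..\<sigma>} \<inter> {\<sigma>..\<sigma> + h} = {\<sigma>}"
    using assms by auto
  have Un: "insert \<sigma> {0..\<sigma>} = {0..\<sigma>}" "insert \<sigma> {\<sigma>..\<sigma> + h} = {\<sigma>..\<sigma> + h}"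
    using assms by auto
  have v': "((\<lambda>t. v (t - \<sigma>)) has_vector_derivative F (v (t - \<sigma>))) (at t within {\<sigma>..\<sigma> + h})"
    if "t \<in> {\<sigma>..\<sigma> + h}"
  proof -
    have "(\<lambda>t. t - \<sigma>) ` {\<sigma>..\<sigma> + h} = {0..h}" by simp
    moreover have "(v has_vector_derivative F (v (t - \<sigma>))) (at (t - \<sigma>) within {0..h})"
      using v that unfolding flow_on_def by auto
    moreover have "((\<lambda>t. t - \<sigma>) has_vector_derivative 1) (at t within {\<sigma>..\<sigma> + h})"
      by (auto intro!: derivative_eq_intros)
    ultimately show ?thesis
      using vector_diff_chain_within[of "\<lambda>t. t - \<sigma>" 1 t "{\<sigma>..\<sigma> + h}" v "F (v (t - \<sigma>))"]
      by (simp add: o_def)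
  qed
  have "((\<lambda>t. if t \<in> {0..\<sigma>} then u t else v (t - \<sigma>)) has_vector_derivative
      (if t \<in> {0..\<sigma>} then F (u t) else F (v (t - \<sigma>)))) (at t within {0..\<sigma> + h})"
  proof (rule has_vector_derivative_If_within_closures[where T = "{\<sigma>..\<sigma> + h}"])
    show "t \<in> {0..\<sigma>} \<union> {\<sigma>..\<sigma> + h}" using t by auto
    show "{0..\<sigma> + h} = {0..\<sigma>} \<union> {\<sigma>..\<sigma> + h}" using assms by auto
  qed (use assms u v' in \<open>auto simp: cl Un flow_on_def\<close>)
  then show "((\<lambda>t. if t \<in> {0..\<sigma>} then u t else v (t - \<sigma>)) has_vector_derivative
      F (if t \<in> {0..\<sigma>} then u t else v (t - \<sigma>))) (at t within {0..\<sigma> + h})"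
    by (simp add: if_distrib[of F])
qed

text \<open>
  Solutions with a common modulus of continuity cannot break down before \<open>T\<close>. Let \<open>\<sigma>\<close> be the
  supremum of the times up to which a solution from \<open>p\<close> exists. By uniqueness the solutions fit
  together to one curve on \<open>[0,\<sigma>)\<close>; it is uniformly continuous, so it extends continuously to \<open>\<sigma>\<close>,
  and the extension solves the equation there too. If \<open>\<sigma> < T\<close>, a local solution from the end point
  would prolong it.
\<close>
lemma flow_on_exists_globally:
  fixes F :: "'a::{real_inner, complete_space} \<Rightarrow> 'a"
  assumes lip: "local_lipschitz {0::real} UNIV (\<lambda>_. F)" and "0 \<le> T"
    and equi: "\<And>e. e > 0 \<Longrightarrow> \<exists>d>0. \<forall>\<sigma> u. \<sigma> \<le> T \<longrightarrow> flow_on F \<sigma> u \<longrightarrow> u 0 = p \<longrightarrow>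
      (\<forall>s\<in>{0..\<sigma>}. \<forall>t\<in>{0..\<sigma>}. dist s t < d \<longrightarrow> dist (u s) (u t) < e)"
  obtains u where "flow_on F T u" "u 0 = p"
proof -
  define S where "S = {\<sigma>. 0 \<le> \<sigma> \<and> \<sigma> \<le> T \<and> (\<exists>u. flow_on F \<sigma> u \<and> u 0 = p)}"
  have "\<forall>\<sigma>\<in>S. \<exists>u. flow_on F \<sigma> u \<and> u 0 = p"
    by (simp add: S_def)
  then obtain w where w: "\<And>\<sigma>. \<sigma> \<in> S \<Longrightarrow> flow_on F \<sigma> (w \<sigma>)" "\<And>\<sigma>. \<sigma> \<in> S \<Longrightarrow> w \<sigma> 0 = p"
    by metis
  have S: "0 \<le> \<sigma>" "\<sigma> \<le> T" if "\<sigma> \<in> S" for \<sigma>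
    using that by (auto simp: S_def)
  have contF: "continuous_on UNIV F"
    by (rule local_lipschitz_continuous_on[OF lip]) simp
  have zero: "0 \<in> S"
  proof -
    have "flow_on F 0 (\<lambda>_. p)"
      by (rule flow_onI_interior[OF contF]) auto
    then show ?thesis using \<open>0 \<le> T\<close> by (auto simp: S_def)
  qed
  have down: "s \<in> S" if "\<sigma> \<in> S" "0 \<le> s" "s \<le> \<sigma>" for s \<sigma>
    using flow_on_subset[OF w(1)[OF that(1)] that(3)] w(2)[OF that(1)] S[OF that(1)] that
    by (auto simp: S_def)
  have agree: "w s s = w \<sigma> s" if "\<sigma> \<in> S" "0 \<le> s" "s \<le> \<sigma>" for s \<sigma>
    by (rule flow_on_unique[OF lip w(1)[OF down[OF that]] flow_on_subset[OF w(1)[OF that(1)] that(3)]])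
      (use w(2) down that in auto)
  define \<sigma> where "\<sigma> = Sup S"
  have bdd: "bdd_above S" using S by (auto intro!: bdd_aboveI)
  have le\<sigma>: "s \<le> \<sigma>" if "s \<in> S" for s
    unfolding \<sigma>_def by (rule cSup_upper[OF that bdd])
  have "0 \<le> \<sigma>" using le\<sigma> zero by blast
  have "\<sigma> \<le> T"
    unfolding \<sigma>_def using zero S by (intro cSup_least) auto
  have lt\<sigma>: "\<exists>\<tau>\<in>S. s < \<tau>" if "s < \<sigma>" for s
    using less_cSup_iff[of S s] zero bdd that unfolding \<sigma>_def by blast
  have in_S: "s \<in> S" if "0 \<le> s" "s < \<sigma>" for s
    using lt\<sigma>[OF that(2)] down that(1) by force
  have "\<sigma> \<in> S"
  proof (cases "\<sigma> = 0")
    case False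
    then have "0 < \<sigma>" using \<open>0 \<le> \<sigma>\<close> by simp
    \<comment> \<open>by uniqueness the diagonal \<open>v\<close> agrees with every \<open>w \<tau>\<close> on \<open>[0,\<tau>]\<close>\<close>
    define v where "v s = w s s" for s
    have "uniformly_continuous_on {0..<\<sigma>} v"
      unfolding uniformly_continuous_on_def
    proof (intro allI impI)
      fix e :: real assume "0 < e"
      then obtain d where "d > 0" and
        d: "\<And>\<sigma> u s t. \<sigma> \<le> T \<Longrightarrow> flow_on F \<sigma> u \<Longrightarrow> u 0 = p \<Longrightarrow> s \<in> {0..\<sigma>} \<Longrightarrow> t \<in> {0..\<sigma>} \<Longrightarrow>
          dist s t < d \<Longrightarrow> dist (u s) (u t) < e"
        using equi by meson
      have "dist (v s) (v t) < e" if "s \<in> {0..<\<sigma>}" "t \<in> {0..<\<sigma>}" "dist s t < d" for s t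
      proof -
        have m: "max s t \<in> S" using that by (intro in_S) auto
        have "dist (w (max s t) s) (w (max s t) t) < e"
          using S[OF m] w[OF m] that by (intro d[of "max s t"]) auto
        then show ?thesis
          using agree[OF m, of s] agree[OF m, of t] that by (auto simp: v_def)
      qed
      then show "\<exists>d>0. \<forall>x\<in>{0..<\<sigma>}. \<forall>x'\<in>{0..<\<sigma>}. dist x' x < d \<longrightarrow> dist (v x') (v x) < e"
        using \<open>d > 0\<close> by blast
    qed
    then obtain g where g: "uniformly_continuous_on (closure {0..<\<sigma>}) g" "\<And>s. s \<in> {0..<\<sigma>} \<Longrightarrow> v s = g s"
      by (rule uniformly_continuous_on_extension_on_closure) blast
    have "flow_on F \<sigma> g"
    proof (rule flow_onI_interior[OF contF])
      show "continuous_on {0..\<sigma>} g"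
        using uniformly_continuous_imp_continuous[OF g(1)] \<open>0 < \<sigma>\<close> by simp
      fix t assume t: "0 < t" "t < \<sigma>"
      then obtain \<tau> where \<tau>: "\<tau> \<in> S" "t < \<tau>" using lt\<sigma> by blast
      have eq: "w \<tau> s = g s" if "s \<in> {0<..<\<tau>}" for s
        using agree[OF \<tau>(1), of s] g(2)[of s] le\<sigma>[OF \<tau>(1)] that by (auto simp: v_def)
      have "(w \<tau> has_vector_derivative F (w \<tau> t)) (at t)"
        using flow_on_at[OF w(1)[OF \<tau>(1)] t(1) \<tau>(2)] .
      then have "(g has_vector_derivative F (w \<tau> t)) (at t)"
        by (rule has_vector_derivative_transform_within_open[where S = "{0<..<\<tau>}"]) (use t \<tau> eq in auto)
      then show "(g has_vector_derivative F (g t)) (at t)"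
        using eq[of t] t \<tau> by simp
    qed
    moreover have "g 0 = p"
      using g(2)[of 0] \<open>0 < \<sigma>\<close> w(2)[OF zero] by (simp add: v_def)
    ultimately show ?thesis
      using \<open>0 \<le> \<sigma>\<close> \<open>\<sigma> \<le> T\<close> unfolding S_def by blast
  qed (use zero in simp)
  have "\<sigma> = T"
  proof (rule ccontr)
    assume "\<sigma> \<noteq> T"
    obtain r L where "r > 0" "L-lipschitz_on (cball (w \<sigma> \<sigma>) r) F"
      using local_lipschitzE[OF lip, of 0 "w \<sigma> \<sigma>"]
      by (metis IntI Int_UNIV_right UNIV_I centre_in_cball less_imp_le singletonI)
    then obtain h z where "h > 0" and z: "flow_on F h z" "z 0 = w \<sigma> \<sigma>"
      by (rule flow_on_exists_locally)
    define k where "k = min h (T - \<sigma>)"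
    have k: "k > 0" "\<sigma> + k \<le> T" "k \<le> h"
      using \<open>h > 0\<close> \<open>\<sigma> \<noteq> T\<close> \<open>\<sigma> \<le> T\<close> by (auto simp: k_def)
    have "flow_on F (\<sigma> + k) (\<lambda>t. if t \<in> {0..\<sigma>} then w \<sigma> t else z (t - \<sigma>))"
      using w(1)[OF \<open>\<sigma> \<in> S\<close>] flow_on_subset[OF z(1) k(3)] z(2) \<open>0 \<le> \<sigma>\<close> k(1)
      by (intro flow_on_append) auto
    moreover have "(if 0 \<in> {0..\<sigma>} then w \<sigma> 0 else z (0 - \<sigma>)) = p"
      using w(2)[OF \<open>\<sigma> \<in> S\<close>] \<open>0 \<le> \<sigma>\<close> by simp
    ultimately have "\<sigma> + k \<in> S"
      using k \<open>0 \<le> \<sigma>\<close> unfolding S_def by (smt (verit) mem_Collect_eq)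
    then show False using le\<sigma> k(1) by fastforce
  qed
  then show ?thesis
    using w[OF \<open>\<sigma> \<in> S\<close>] by (intro that[of "w \<sigma>"]) auto
qed

section \<open>Gradient flows\<close>

lemma has_vector_derivative_compose_GDERIV:
  assumes "(u has_vector_derivative u') (at t within S)" "GDERIV f (u t) :> g"
  shows "((\<lambda>t. f (u t)) has_vector_derivative inner u' g) (at t within S)"
  using has_derivative_compose[of u "\<lambda>h. h *\<^sub>R u'" t S f "\<lambda>h. inner h g"] assms
  by (simp add: has_vector_derivative_def gderiv_def)

text \<open>
  This plays the role of the Hoelder estimate
  \<open>|u(t) - u(s)| \<le> sqrt(t - s) sqrt(\<psi>(u(s)) - \<psi>(u(t)))\<close> but avoids integrals: by Young's inequality
  \<open>|u'| = |\<nabla>\<psi>(u)| \<le> \<kappa> + |\<nabla>\<psi>(u)|\<^sup>2 / \<kappa>\<close>, and the right-hand side is the derivative of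
  \<open>\<kappa> t - \<psi>(u(t)) / \<kappa>\<close>.
\<close>
lemma gradient_flow_increment_bound:
  fixes \<psi> :: "'a::real_inner \<Rightarrow> real"
  assumes grad: "\<And>x. GDERIV \<psi> x :> grad \<psi> x"
    and u: "flow_on (\<lambda>x. - grad \<psi> x) T u" and "0 \<le> s" "s \<le> t" "t \<le> T" and "\<kappa> > 0"
  shows "norm (u t - u s) \<le> \<kappa> * (t - s) + (\<psi> (u s) - \<psi> (u t)) / \<kappa>"
proof (cases "s = t")
  case False
  define \<phi> where "\<phi> t = \<kappa> * t - \<psi> (u t) / \<kappa>" for t
  have cont: "continuous_on {0..T} (\<lambda>t. \<psi> (u t))"
    by (rule continuous_on_vector_derivative)
      (use u in \<open>auto simp: flow_on_def intro!: has_vector_derivative_compose_GDERIV grad\<close>)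
  have "norm (u t - u s) \<le> \<phi> t - \<phi> s"
  proof (rule differentiable_bound_general)
    show "s < t" using False \<open>s \<le> t\<close> by simp
    show "continuous_on {s..t} u" "continuous_on {s..t} \<phi>"
      unfolding \<phi>_def using assms
      by (intro continuous_intros continuous_on_subset[OF flow_on_continuous[OF u]]
          continuous_on_subset[OF cont]; auto)+
    fix x assume x: "s < x" "x < t"
    show u': "(u has_vector_derivative - grad \<psi> (u x)) (at x)"
      using flow_on_at[OF u, of x] x assms by simp
    have "((\<lambda>t. \<psi> (u t)) has_real_derivative - (norm (grad \<psi> (u x)))\<^sup>2) (at x)"
      using has_vector_derivative_compose_GDERIV[OF u' grad]
      by (simp add: has_real_derivative_iff_has_vector_derivative power2_norm_eq_inner)
    then have "(\<phi> has_real_derivative \<kappa> + (norm (grad \<psi> (u x)))\<^sup>2 / \<kappa>) (at x)"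
      unfolding \<phi>_def using \<open>\<kappa> > 0\<close> by (auto intro!: derivative_eq_intros)
    then show "(\<phi> has_vector_derivative \<kappa> + (norm (grad \<psi> (u x)))\<^sup>2 / \<kappa>) (at x)"
      by (simp add: has_real_derivative_iff_has_vector_derivative)
    have "0 \<le> (norm (grad \<psi> (u x)) - \<kappa>)\<^sup>2 + norm (grad \<psi> (u x)) * \<kappa>"
      using \<open>\<kappa> > 0\<close> by simp
    then have "norm (grad \<psi> (u x)) * \<kappa> \<le> \<kappa>\<^sup>2 + (norm (grad \<psi> (u x)))\<^sup>2"
      by (simp add: power2_diff algebra_simps)
    then show "norm (- grad \<psi> (u x)) \<le> \<kappa> + (norm (grad \<psi> (u x)))\<^sup>2 / \<kappa>"
      using \<open>\<kappa> > 0\<close> by (simp add: field_simps power2_eq_square)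
  qed
  then show ?thesis
    by (simp add: \<phi>_def algebra_simps diff_divide_distrib)
qed simp

lemma gradient_flow_nonincreasing:
  fixes \<psi> :: "'a::real_inner \<Rightarrow> real"
  assumes grad: "\<And>x. GDERIV \<psi> x :> grad \<psi> x"
    and u: "flow_on (\<lambda>x. - grad \<psi> x) T u" and "0 \<le> t" "t \<le> T"
  shows "\<psi> (u t) \<le> \<psi> (u 0)"
proof (cases "t = 0")
  case False
  have deriv: "((\<lambda>t. \<psi> (u t)) has_vector_derivative - (norm (grad \<psi> (u x)))\<^sup>2) (at x within {0..T})"
    if "x \<in> {0..T}" for x
    using has_vector_derivative_compose_GDERIV[OF _ grad, of u "- grad \<psi> (u x)" x "{0..T}"] u that
    by (simp add: flow_on_def power2_norm_eq_inner)
  show ?thesis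
  proof (rule DERIV_nonpos_imp_decreasing_open[where f = "\<lambda>t. \<psi> (u t)"])
    show "continuous_on {0..t} (\<lambda>t. \<psi> (u t))"
      using continuous_on_vector_derivative[OF deriv] assms by (auto intro: continuous_on_subset)
    fix x assume "0 < x" "x < t"
    then have "((\<lambda>t. \<psi> (u t)) has_real_derivative - (norm (grad \<psi> (u x)))\<^sup>2) (at x)"
      using deriv[of x] assms
      by (simp add: has_real_derivative_iff_has_vector_derivative at_within_Icc_at)
    then show "\<exists>y. ((\<lambda>t. \<psi> (u t)) has_real_derivative y) (at x) \<and> y \<le> 0"
      by (intro exI conjI) auto
  qed (use assms False in auto)
qed simp

text \<open>
  The total decrease of \<open>\<psi>\<close> along a flow from \<open>p\<close> is less than \<open>C = \<psi>(p) - m + 1\<close>, where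
  \<open>m\<close> is a lower bound of \<open>\<psi>\<close>. In the increment bound the choice \<open>\<kappa> = 2C / e\<close> makes the energy term less than \<open>e / 2\<close>, and the other term
  is less than \<open>e / 2\<close> for time steps below \<open>e / (2\<kappa>)\<close>. This is a modulus of continuity common to all
  flows from \<open>p\<close>. The summand \<open>1\<close> keeps \<open>C\<close> positive even if \<open>\<psi>(p) = m\<close>.
\<close>
lemma gradient_flow_exists:
  fixes \<psi> :: "'a::{real_inner, complete_space} \<Rightarrow> real"
  assumes C2: "C2_function \<psi>" and bdd: "bdd_below (range \<psi>)" and "0 \<le> T"
  obtains u where "gradient_flow_on \<psi> T u" "u 0 = p"
proof -
  have grad: "GDERIV \<psi> x :> grad \<psi> x" for x
    using C2 by (intro GDERIV_grad) (auto simp: C2_function_def differentiable_def)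
  obtain m where m: "\<And>x. m \<le> \<psi> x"
    using bdd by (auto simp: bdd_below_def)
  define C where "C = \<psi> p - m + 1"
  have "C > 0" using m[of p] by (simp add: C_def)
  have "local_lipschitz {0::real} UNIV (\<lambda>_ x. - grad \<psi> x)"
    using local_lipschitz_grad[OF C2] local_lipschitz_minus[of "{0::real}" UNIV "\<lambda>_. grad \<psi>"] by simp
  then obtain u where "flow_on (\<lambda>x. - grad \<psi> x) T u" "u 0 = p"
  proof (rule flow_on_exists_globally)
    fix e :: real assume "e > 0"
    define \<kappa> where "\<kappa> = 2 * C / e"
    have "\<kappa> > 0" using \<open>C > 0\<close> \<open>e > 0\<close> by (simp add: \<kappa>_def)
    have *: "dist (u t) (u s) < e"
      if "\<sigma> \<le> T" "flow_on (\<lambda>x. - grad \<psi> x) \<sigma> u" "u 0 = p" "0 \<le> s" "s \<le> t" "t \<le> \<sigma>" "t - s < e / (2 * \<kappa>)"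
      for \<sigma> u s t
    proof -
      have "\<psi> (u s) - \<psi> (u t) < C"
        using gradient_flow_nonincreasing[OF grad that(2), of s] that m[of "u t"] by (simp add: C_def)
      then have "(\<psi> (u s) - \<psi> (u t)) / \<kappa> < C / \<kappa>"
        using \<open>\<kappa> > 0\<close> by (rule divide_strict_right_mono)
      also have "C / \<kappa> = e / 2"
        using \<open>C > 0\<close> \<open>e > 0\<close> by (simp add: \<kappa>_def)
      finally have "(\<psi> (u s) - \<psi> (u t)) / \<kappa> < e / 2" .
      moreover have "\<kappa> * (t - s) < e / 2"
        using that(7) \<open>\<kappa> > 0\<close> by (simp add: field_simps)
      ultimately show ?thesis
        using gradient_flow_increment_bound[OF grad that(2,4,5,6) \<open>\<kappa> > 0\<close>] unfolding dist_norm by linarith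
    qed
    have "dist (u s) (u t) < e"
      if "\<sigma> \<le> T" "flow_on (\<lambda>x. - grad \<psi> x) \<sigma> u" "u 0 = p" "s \<in> {0..\<sigma>}" "t \<in> {0..\<sigma>}" "dist s t < e / (2 * \<kappa>)"
      for \<sigma> u s t
      using *[OF that(1-3), of s t] *[OF that(1-3), of t s] that
      by (cases "s \<le> t") (auto simp: dist_commute dist_real_def)
    then show "\<exists>d>0. \<forall>\<sigma> u. \<sigma> \<le> T \<longrightarrow> flow_on (\<lambda>x. - grad \<psi> x) \<sigma> u \<longrightarrow> u 0 = p \<longrightarrow>
      (\<forall>s\<in>{0..\<sigma>}. \<forall>t\<in>{0..\<sigma>}. dist s t < d \<longrightarrow> dist (u s) (u t) < e)"
      using \<open>e > 0\<close> \<open>\<kappa> > 0\<close> by (intro exI[of _ "e / (2 * \<kappa>)"]) auto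
  qed (use \<open>0 \<le> T\<close> in blast)+
  then show ?thesis
    using that by (auto simp: flow_on_def gradient_flow_on_def)
qed


section \<open>The action functional\<close>

text \<open>
  The identity \<open>|w'|\<^sup>2 / 2 + |\<nabla>\<psi>(w)|\<^sup>2 / 2 = |w' + \<nabla>\<psi>(w)|\<^sup>2 / 2 - (\<psi> \<circ> w)'\<close> is integrated over compact
  intervals \<open>[c,d]\<close> inside \<open>(0,T)\<close>, since \<open>w'\<close> may be unbounded at the end points; then \<open>c\<close> tends to
  \<open>0\<close> and \<open>d\<close> to \<open>T\<close>. Keeping the squared defect only on a fixed \<open>[a,b]\<close> avoids any question of
  integrability on \<open>(0,T)\<close>, and is enough to show that the defect vanishes when equality holds.
\<close>
lemma J_ge_initial_value_plus_defect:
  fixes \<psi> :: "'a::{real_inner, complete_space} \<Rightarrow> real"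
  assumes grad: "\<And>x. GDERIV \<psi> x :> grad \<psi> x" and contg: "continuous_on UNIV (grad \<psi>)"
    and adm: "admissible_curve T w" and ab: "0 < a" "a \<le> b" "b < T"
  shows "ereal (integral {a..b} (\<lambda>t. 1/2 * (norm (vector_derivative w (at t) + grad \<psi> (w t)))\<^sup>2) + \<psi> (w 0))
    \<le> J \<psi> T w"
proof -
  define w' where "w' t = vector_derivative w (at t)" for t
  define G where "G t = 1/2 * (norm (w' t + grad \<psi> (w t)))\<^sup>2" for t
  define L where "L t = 1/2 * (norm (w' t))\<^sup>2 + 1/2 * (norm (grad \<psi> (w t)))\<^sup>2" for t
  define N where "N = (\<integral>\<^sup>+t\<in>{0<..<T}. ennreal (L t) \<partial>lborel)"
  have J: "J \<psi> T w = enn2ereal N + ereal (\<psi> (w T))"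
    by (simp add: J_def N_def L_def w'_def)
  have contw: "continuous_on {0..T} w"
    using adm by (simp add: admissible_curve_def)
  have contw': "continuous_on {0<..<T} w'" and w': "\<And>t. t \<in> {0<..<T} \<Longrightarrow> (w has_vector_derivative w' t) (at t)"
    using adm by (auto simp: admissible_curve_def C1_differentiable_on_eq w'_def vector_derivative_works)
  have cont\<psi>: "continuous_on {0..T} (\<lambda>t. \<psi> (w t))"
  proof (rule continuous_on_compose2[OF _ contw])
    show "continuous_on UNIV \<psi>"
      using grad unfolding gderiv_def by (intro has_derivative_continuous_on) auto
  qed auto
  have contG: "continuous_on {0<..<T} G"
    unfolding G_def
    by (intro continuous_intros contw' continuous_on_compose2[OF contg] continuous_on_subset[OF contw]) auto
  have L_eq: "L t = G t - inner (w' t) (grad \<psi> (w t))" for t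
    by (simp add: L_def G_def power2_norm_eq_inner inner_add_left inner_add_right inner_commute field_simps)
  define I where "I = integral {a..b} G"
  have le_N: "ennreal (I - (\<psi> (w d) - \<psi> (w c))) \<le> N" if "0 < c" "c \<le> a" "b \<le> d" "d < T" for c d
  proof -
    have sub: "{c..d} \<subseteq> {0<..<T}" using that by auto
    have "((\<lambda>t. inner (w' t) (grad \<psi> (w t))) has_integral \<psi> (w d) - \<psi> (w c)) {c..d}"
    proof (rule fundamental_theorem_of_calculus)
      show "((\<lambda>t. \<psi> (w t)) has_vector_derivative inner (w' t) (grad \<psi> (w t))) (at t within {c..d})"
        if "t \<in> {c..d}" for t
        using sub that
        by (intro has_vector_derivative_compose_GDERIV grad has_vector_derivative_at_within[OF w']) auto
    qed (use that ab in simp)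
    moreover have intG: "G integrable_on {c..d}"
      by (intro integrable_continuous_real continuous_on_subset[OF contG sub])
    ultimately have L_int: "(L has_integral integral {c..d} G - (\<psi> (w d) - \<psi> (w c))) {c..d}"
      unfolding L_eq by (intro has_integral_diff integrable_integral)
    have "I \<le> integral {c..d} G"
      unfolding I_def
      by (rule integral_subset_le)
        (use that intG integrable_on_subinterval[OF intG, of a b] in \<open>auto simp: G_def\<close>)
    then have "ennreal (I - (\<psi> (w d) - \<psi> (w c))) \<le> ennreal (integral {c..d} G - (\<psi> (w d) - \<psi> (w c)))"
      by (intro ennreal_leI) simp
    also have "\<dots> = (\<integral>\<^sup>+t. ennreal (indicator {c..d} t * L t) \<partial>lborel)"
      by (rule nn_integral_has_integral_lebesgue[symmetric, OF _ L_int]) (simp add: L_def)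
    also have "\<dots> \<le> N"
      unfolding N_def using sub by (intro nn_integral_mono) (auto split: split_indicator)
    finally show ?thesis .
  qed
  show ?thesis
  proof (cases "N = \<infinity>")
    case True
    then show ?thesis by (simp add: J)
  next
    case False
    then obtain r where r: "N = ennreal r" "r \<ge> 0" by (cases N) auto
    have le_r: "I + \<psi> (w c) \<le> r + \<psi> (w d)" if "0 < c" "c \<le> a" "b \<le> d" "d < T" for c d
      using le_N[OF that] r by (simp add: ennreal_le_iff)
    have le_T: "I + \<psi> (w c) \<le> r + \<psi> (w T)" if "0 < c" "c \<le> a" for c
    proof (intro tendsto_lowerbound[where F = "at_left T"])
      show "((\<lambda>d. r + \<psi> (w d)) \<longlongrightarrow> r + \<psi> (w T)) (at_left T)"
        using ab by (intro tendsto_intros continuous_on_Icc_at_leftD[OF cont\<psi>]) auto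
      have "\<forall>\<^sub>F d in at_left T. d \<in> {b<..<T}"
        by (rule eventually_at_left_real[OF ab(3)])
      then show "\<forall>\<^sub>F d in at_left T. I + \<psi> (w c) \<le> r + \<psi> (w d)"
        by eventually_elim (use that le_r in auto)
    qed simp
    have "I + \<psi> (w 0) \<le> r + \<psi> (w T)"
    proof (intro tendsto_upperbound[where F = "at_right 0"])
      show "((\<lambda>c. I + \<psi> (w c)) \<longlongrightarrow> I + \<psi> (w 0)) (at_right 0)"
        using ab by (intro tendsto_intros continuous_on_Icc_at_rightD[OF cont\<psi>]) auto
      have "\<forall>\<^sub>F c in at_right 0. c \<in> {0<..<a}"
        by (rule eventually_at_right_real[OF ab(1)])
      then show "\<forall>\<^sub>F c in at_right 0. I + \<psi> (w c) \<le> r + \<psi> (w T)"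
        by eventually_elim (use le_T in auto)
    qed simp
    then show ?thesis
      using r by (simp add: J I_def G_def[abs_def] w'_def)
  qed
qed

text \<open>
  Along a flow the integrand equals \<open>|\<nabla>\<psi>(u)|\<^sup>2 = - (\<psi> \<circ> u)'\<close>, so the integral telescopes to
  \<open>\<psi>(u(0)) - \<psi>(u(T))\<close>.
\<close>
lemma J_gradient_flow:
  fixes \<psi> :: "'a::{real_inner, complete_space} \<Rightarrow> real"
  assumes grad: "\<And>x. GDERIV \<psi> x :> grad \<psi> x" and u: "gradient_flow_on \<psi> T u" and "0 \<le> T"
  shows "J \<psi> T u = ereal (\<psi> (u 0))"
proof -
  define V where "V t = (norm (grad \<psi> (u t)))\<^sup>2" for t
  have flow: "flow_on (\<lambda>x. - grad \<psi> x) T u"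
    using u by (simp add: flow_on_def gradient_flow_on_def)
  have "(V has_integral - \<psi> (u T) - (- \<psi> (u 0))) {0..T}"
  proof (rule fundamental_theorem_of_calculus)
    fix t assume "t \<in> {0..T}"
    then have "((\<lambda>t. \<psi> (u t)) has_vector_derivative inner (- grad \<psi> (u t)) (grad \<psi> (u t))) (at t within {0..T})"
      using flow by (intro has_vector_derivative_compose_GDERIV grad) (auto simp: flow_on_def)
    from has_vector_derivative_minus[OF this]
    show "((\<lambda>t. - \<psi> (u t)) has_vector_derivative V t) (at t within {0..T})"
      by (simp add: V_def power2_norm_eq_inner)
  qed fact
  then have int: "(V has_integral \<psi> (u 0) - \<psi> (u T)) {0<..<T}"
    by (simp add: has_integral_Icc_iff_Ioo)
  have "0 \<le> \<psi> (u 0) - \<psi> (u T)"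
    by (rule has_integral_nonneg[OF int]) (simp add: V_def)
  have "(\<integral>\<^sup>+t\<in>{0<..<T}. ennreal (1/2 * (norm (vector_derivative u (at t)))\<^sup>2
      + 1/2 * (norm (grad \<psi> (u t)))\<^sup>2) \<partial>lborel) = (\<integral>\<^sup>+t. ennreal (indicator {0<..<T} t * V t) \<partial>lborel)"
    using vector_derivative_at[OF flow_on_at[OF flow]]
    by (intro nn_integral_cong) (auto simp: V_def ennreal_plus[symmetric] simp del: ennreal_plus split: split_indicator)
  also have "\<dots> = ennreal (\<psi> (u 0) - \<psi> (u T))"
    by (rule nn_integral_has_integral_lebesgue[OF _ int]) (simp add: V_def)
  finally show ?thesis
    using \<open>0 \<le> \<psi> (u 0) - \<psi> (u T)\<close> by (simp add: J_def)
qed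

lemma admissible_gradient_flow:
  assumes "continuous_on UNIV (grad \<psi>)" and u: "gradient_flow_on \<psi> T u"
  shows "admissible_curve T u"
proof -
  have flow: "flow_on (\<lambda>x. - grad \<psi> x) T u"
    using u by (simp add: flow_on_def gradient_flow_on_def)
  have cont: "continuous_on {0..T} u" by (rule flow_on_continuous[OF flow])
  then have "continuous_on {0<..<T} (\<lambda>t. - grad \<psi> (u t))"
    by (intro continuous_intros continuous_on_compose2[OF assms(1)] continuous_on_subset[OF cont]) auto
  then show ?thesis
    using cont flow_on_at[OF flow] unfolding admissible_curve_def C1_differentiable_on_def
    by (intro conjI exI[of _ "\<lambda>t. - grad \<psi> (u t)"]) auto
qed

theorem proposition3p22:
  fixes \<psi> :: "'a::{real_inner, complete_space} \<Rightarrow> real"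
    and T :: real
    and u :: "real \<Rightarrow> 'a"
  assumes "C2_function \<psi>"
    and "bdd_below (range \<psi>)"
    and "convex_on UNIV (\<lambda>x. 1/2 * (norm (grad \<psi> x))\<^sup>2)"
    and "T > 0"
    and "admissible_curve T u"
  shows "gradient_flow_on \<psi> T u \<longleftrightarrow>
    (\<forall>w. admissible_curve T w \<and> w 0 = u 0 \<longrightarrow> J \<psi> T u \<le> J \<psi> T w)"
proof -
  have grad: "GDERIV \<psi> x :> grad \<psi> x" for x
    using assms(1) by (intro GDERIV_grad) (auto simp: C2_function_def differentiable_def)
  have contg: "continuous_on UNIV (grad \<psi>)"
    by (rule local_lipschitz_continuous_on[OF local_lipschitz_grad[OF assms(1)]]) simp
  show ?thesis
  proof
    assume flow: "gradient_flow_on \<psi> T u"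
    show "\<forall>w. admissible_curve T w \<and> w 0 = u 0 \<longrightarrow> J \<psi> T u \<le> J \<psi> T w"
    proof (intro allI impI)
      fix w assume w: "admissible_curve T w \<and> w 0 = u 0"
      show "J \<psi> T u \<le> J \<psi> T w"
        using J_ge_initial_value_plus_defect[OF grad contg, of T w "T/2" "T/2"]
          J_gradient_flow[OF grad flow] w \<open>T > 0\<close> by simp
    qed
  next
    \<comment> \<open>Comparison with the flow from \<open>u(0)\<close> gives \<open>J(T; u) \<le> \<psi>(u(0))\<close>; the lower bound leaves no room for a defect.\<close>
    assume min: "\<forall>w. admissible_curve T w \<and> w 0 = u 0 \<longrightarrow> J \<psi> T u \<le> J \<psi> T w"
    obtain v where v: "gradient_flow_on \<psi> T v" "v 0 = u 0"
      using gradient_flow_exists[OF assms(1,2), of T "u 0"] \<open>T > 0\<close> by auto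
    have "J \<psi> T u \<le> J \<psi> T v"
      using min admissible_gradient_flow[OF contg v(1)] v(2) by blast
    also have "\<dots> = ereal (\<psi> (u 0))"
      using J_gradient_flow[OF grad v(1)] v(2) \<open>T > 0\<close> by simp
    finally have J_le: "J \<psi> T u \<le> ereal (\<psi> (u 0))" .
    define u' where "u' t = vector_derivative u (at t)" for t
    define G where "G t = 1/2 * (norm (u' t + grad \<psi> (u t)))\<^sup>2" for t
    have contu: "continuous_on {0..T} u" and contu': "continuous_on {0<..<T} u'"
      and u': "\<And>t. t \<in> {0<..<T} \<Longrightarrow> (u has_vector_derivative u' t) (at t)"
      using assms(5) by (auto simp: admissible_curve_def C1_differentiable_on_eq u'_def vector_derivative_works)
    have contG: "continuous_on {0<..<T} G"
      unfolding G_def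
      by (intro continuous_intros contu' continuous_on_compose2[OF contg] continuous_on_subset[OF contu]) auto
    have "u' t = - grad \<psi> (u t)" if t: "0 < t" "t < T" for t
    proof -
      define b where "b = (t + T) / 2"
      have b: "t < b" "b < T" using t by (simp_all add: b_def)
      have cont: "continuous_on {t..b} G"
        by (rule continuous_on_subset[OF contG]) (use t b in auto)
      have "ereal (integral {t..b} G + \<psi> (u 0)) \<le> ereal (\<psi> (u 0))"
        using J_ge_initial_value_plus_defect[OF grad contg assms(5) t(1), of b] J_le b
        unfolding G_def u'_def by (meson less_imp_le order_trans)
      then have "integral {t..b} G \<le> 0" by simp
      moreover have "0 \<le> integral {t..b} G"
        by (intro integral_nonneg integrable_continuous_real cont) (simp add: G_def)
      ultimately have "G t = 0"
        using integral_eq_0_iff[OF cont b(1)] b(1) by (auto simp: G_def)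
      then show ?thesis
        by (simp add: G_def eq_neg_iff_add_eq_0)
    qed
    then have "flow_on (\<lambda>x. - grad \<psi> x) T u"
      using u' by (intro flow_onI_interior contu continuous_on_minus contg) auto
    then show "gradient_flow_on \<psi> T u"
      by (simp add: flow_on_def gradient_flow_on_def)
  qed
qed

end
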